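(* Let $T$ be a triangulation of a convex $m$-gon ($m\ge2$) with vertices $1,\dots,m$ in cyclic order (indices modulo $m$), equipped with an admissible labelling. Then at least one of the following holds: (0) $m<4$, and the labelling is either empty or consists of a single triangle labelled $1$. (1) There is $k$ such that $(k-1,k,k+1)$ is a triangle of $T$ labelled $1$. Removing it yields an admissible labelling of a triangulation of an $(m-1)$-gon. (2) $m$ is odd, and there is $k$ such that the quadrilateral $(k-1,k,k+1,k+2)$ is a square of $T$ labelled $(c,-c)$. Removing it and multiplying all remaining labels by $-1$ yields an admissible labelling of a triangulation of an $(m-2)$-gon. (3) $m$ is even, and there is $k$ such that $(k-1,k,k+1)$ is a triangle labelled $-1$. Removing it and multiplying all remaining labels by $-1$ yields an admissible labelling of a triangulation of an $(m-1)$-gon. (4) There are $j,k$ with $|j-k|>1$ such that $(j-1,j,j+1,j+2)$ and $(k-1,k,k+1,k+2)$ are squares labelled $(c,-c)$ and $(d,-d)$. Removing both yields an admissible labelling of a triangulation of an $(m-4)$-gon. (5) There are $j,k$ with $|j-k|>1$ such that $(j-1,j,j+1)$ and $(k-1,k,k+1)$ are triangles labelled $-1$. Removing both yields an admissible labelling of a triangulation of an $(m-2)$-gon.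
   Context: A triangulation of an $m$-gon is a subdivision into $m-2$ triangles by non-crossing diagonals; for $m=2$ it has no triangles. A labelling assigns an integer $a_t$ to each triangle $t$. Let $d$ be the number of negative labels plus half the number of labels equal to $0$; if $d$ is an integer, the sign is $(-1)^d$. A labelling is admissible if: (i) the triangles $t$ with $a_t\notin\{1,-1\}$ are partitioned into two-element sets $\{t_1,t_2\}$ ("squares") of triangles sharing an edge with $a_{t_1}=-a_{t_2}$; (ii) $d$ is an even integer. A square "$(k-1,k,k+1,k+2)$ labelled $(c,-c)$" means a square of the admissible labelling whose two triangles together form the quadrilateral with vertices $k-1,k,k+1,k+2$, with labels $c$ and $-c$. Removing a triangle $(k-1,k,k+1)$ deletes vertex $k$; removing a square $(k-1,k,k+1,k+2)$ deletes vertices $k,k+1$. *)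

theory Defs
  imports Main
begin

text \<open>A convex polygon is given by a finite vertex set V of naturals, listed in
cyclic order by the natural order of the numbers. A triangle is a 3-element
vertex set; its sides are its 2-element subsets.\<close>

definition chords_cross :: "nat set \<Rightarrow> nat set \<Rightarrow> bool" where
  "chords_cross e f \<longleftrightarrow> (\<exists>a b c d. e = {a, b} \<and> f = {c, d} \<and> a < b \<and> c < d \<and>
      ((a < c \<and> c < b \<and> b < d) \<or> (c < a \<and> a < d \<and> d < b)))"

definition is_triangulation :: "nat set \<Rightarrow> nat set set \<Rightarrow> bool" where
  "is_triangulation V T \<longleftrightarrow> finite V \<and> card V \<ge> 2 \<and> finite T \<and>
     (\<forall>t\<in>T. t \<subseteq> V \<and> card t = 3) \<and> card T = card V - 2 \<and>
     (\<forall>s\<in>T. \<forall>t\<in>T. \<forall>e f. e \<subseteq> s \<and> card e = 2 \<and> f \<subseteq> t \<and> card f = 2 \<longrightarrow> \<not> chords_cross e f)"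

definition square_partition :: "nat set set \<Rightarrow> (nat set \<Rightarrow> int) \<Rightarrow> nat set set set \<Rightarrow> bool" where
  "square_partition T a P \<longleftrightarrow>
     (\<forall>p\<in>P. \<exists>t1 t2. p = {t1, t2} \<and> t1 \<noteq> t2 \<and> t1 \<in> T \<and> t2 \<in> T \<and>
                     card (t1 \<inter> t2) = 2 \<and> a t1 = - a t2) \<and>
     (\<forall>p\<in>P. \<forall>q\<in>P. p \<noteq> q \<longrightarrow> p \<inter> q = {}) \<and>
     \<Union>P = {t\<in>T. a t \<notin> {1, -1}}"

definition sign_even :: "nat set set \<Rightarrow> (nat set \<Rightarrow> int) \<Rightarrow> bool" where
  "sign_even T a \<longleftrightarrow>
     (let N = card {t\<in>T. a t < 0}; Z = card {t\<in>T. a t = 0} in even Z \<and> even (N + Z div 2))"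

definition admissible_wrt :: "nat set \<Rightarrow> nat set set \<Rightarrow> (nat set \<Rightarrow> int) \<Rightarrow> nat set set set \<Rightarrow> bool" where
  "admissible_wrt V T a P \<longleftrightarrow> is_triangulation V T \<and> square_partition T a P \<and> sign_even T a"

definition admissible :: "nat set \<Rightarrow> nat set set \<Rightarrow> (nat set \<Rightarrow> int) \<Rightarrow> bool" where
  "admissible V T a \<longleftrightarrow> (\<exists>P. admissible_wrt V T a P)"

text \<open>Polygon with vertices 0..m-1, indices modulo m.\<close>
definition tri :: "nat \<Rightarrow> nat \<Rightarrow> nat set" where
  "tri m k = {(k + m - 1) mod m, k mod m, (k + 1) mod m}"

definition quad :: "nat \<Rightarrow> nat \<Rightarrow> nat set" where
  "quad m k = {(k + m - 1) mod m, k mod m, (k + 1) mod m, (k + 2) mod m}"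

definition cyc_far :: "nat \<Rightarrow> nat \<Rightarrow> nat \<Rightarrow> bool" where
  "cyc_far m j k \<longleftrightarrow> j mod m \<noteq> k mod m \<and> (j + 1) mod m \<noteq> k mod m \<and> (k + 1) mod m \<noteq> j mod m"

end

theory Submission
  imports Defs
begin

text \<open>
  Glue the two triangles of every square together. The resulting pieces (triangles labelled
  \<open>\<plusminus>1\<close> and squares) form a tree, and for \<open>m \<ge> 4\<close> it has at least two leaves, because a single
  square has odd \<open>d\<close>. Every square contributes exactly \<open>1\<close> to \<open>d\<close>, so \<open>d\<close> has the parity of the number of
  squares plus the number of labels \<open>-1\<close>. A leaf labelled \<open>1\<close> can be removed, and so can two leaves
  of the same kind; if the two leaves are a square and a triangle labelled \<open>-1\<close>, then removing one
  of them changes the parity of \<open>d\<close>, and changing the signs of an odd number of remaining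
  triangles repairs it.

  The tree is rooted at the side \<open>{0, m - 1}\<close>: below a chord \<open>{x, y}\<close> lie the triangles with all
  vertices in \<open>{x..y}\<close>.
\<close>

section \<open>Counting the triangles below a chord\<close>

text \<open>This keeps the part of \<open>is_triangulation\<close> that mentions neither the vertex
  set nor the number of triangles; the upper bound in \<open>card_inside\<close> already holds for
  such families.\<close>

definition noncrossing :: "nat set set \<Rightarrow> bool" where
  "noncrossing T \<longleftrightarrow> finite T \<and> (\<forall>t\<in>T. card t = 3) \<and>
     (\<forall>s\<in>T. \<forall>t\<in>T. \<forall>e f. e \<subseteq> s \<and> card e = 2 \<and> f \<subseteq> t \<and> card f = 2 \<longrightarrow> \<not> chords_cross e f)"

definition inside :: "nat set set \<Rightarrow> nat \<Rightarrow> nat \<Rightarrow> nat set set" where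
  "inside T x y = {t \<in> T. t \<subseteq> {x..y}}"

lemma card_3_nat_sorted:
  fixes t :: "nat set"
  assumes "card t = 3"
  obtains u v w where "u < v" "v < w" "t = {u, v, w}"
proof -
  obtain a b c where t: "t = {a, b, c}" "a \<noteq> b" "b \<noteq> c" "a \<noteq> c"
    using assms by (auto simp: card_3_iff)
  consider "a < b" "b < c" | "a < c" "c < b" | "b < a" "a < c" | "b < c" "c < a"
    | "c < a" "a < b" | "c < b" "b < a"
    using t by linarith
  then show thesis
    by cases (use t that in \<open>(metis insert_commute)+\<close>)
qed

lemma finite_inside: "finite T \<Longrightarrow> finite (inside T x y)"
  by (simp add: inside_def)

text \<open>Otherwise \<open>t\<close> has one vertex strictly between \<open>x\<close> and
  \<open>y\<close> and another outside \<open>{x..y}\<close>, and the edge joining them crosses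
  \<open>{x, y}\<close>. The splitting lemmas below use the crossing condition only in this
  form.\<close>

lemma noncrossing_avoid:
  assumes "noncrossing T" "s \<in> T" "x \<in> s" "y \<in> s" "t \<in> T"
  shows "t \<subseteq> {x..y} \<or> t \<inter> {x<..<y} = {}"
proof (rule ccontr)
  assume "\<not> ?thesis"
  then obtain u v where uv: "u \<in> t" "x < u" "u < y" "v \<in> t" "v < x \<or> y < v"
    by fastforce
  \<comment> \<open>\<open>chords_cross\<close> expects the endpoints of both edges in increasing
    order.\<close>
  define f where "f = {min u v, max u v}"
  have f: "f = {u, v}" unfolding f_def by (auto simp: min_def max_def)
  have "chords_cross {x, y} f"
    unfolding chords_cross_def f_def
    using uv
    by (intro exI[of _ x] exI[of _ y] exI[of _ "min u v"] exI[of _ "max u v"])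
       (auto simp: min_def max_def)
  moreover have "{x, y} \<subseteq> s" "card {x, y} = 2" "f \<subseteq> t" "card f = 2"
    using assms uv f by auto
  ultimately show False
    using assms unfolding noncrossing_def by blast
qed

lemma inside_short:
  assumes "noncrossing T" "y \<le> x + 1"
  shows "inside T x y = {}"
proof -
  have False if "t \<in> T" "t \<subseteq> {x..y}" for t
  proof -
    have "card t \<le> card {x..y}" using that by (intro card_mono) auto
    moreover have "card t = 3" using that assms by (auto simp: noncrossing_def)
    ultimately show False using assms by simp
  qed
  then show ?thesis by (auto simp: inside_def)
qed

text \<open>A triangle below \<open>{x, y}\<close> that fits in neither half avoids both open
  intervals, so its vertices are among \<open>x\<close>, \<open>z\<close>, \<open>y\<close>.\<close>

lemma inside_split_triangle:
  assumes "noncrossing T" "{x, z, y} \<in> T" "x < z" "z < y"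
  shows "inside T x y = insert {x, z, y} (inside T x z \<union> inside T z y)"
proof (intro equalityI subsetI)
  fix t assume "t \<in> inside T x y"
  then have t: "t \<in> T" "t \<subseteq> {x..y}" by (auto simp: inside_def)
  show "t \<in> insert {x, z, y} (inside T x z \<union> inside T z y)"
  proof (rule ccontr)
    assume n: "\<not> ?thesis"
    have "t \<inter> {x<..<z} = {}" "t \<inter> {z<..<y} = {}"
      using noncrossing_avoid[OF assms(1,2) _ _ t(1), of x z]
        noncrossing_avoid[OF assms(1,2) _ _ t(1), of z y] n t
      by (auto simp: inside_def)
    then have "t \<subseteq> {x, z, y}" using t(2) by force
    moreover have "card t = 3" "card {x, z, y} = 3"
      using t assms by (auto simp: noncrossing_def)
    ultimately have "t = {x, z, y}" by (intro card_subset_eq) auto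
    then show False using n by simp
  qed
next
  fix t assume "t \<in> insert {x, z, y} (inside T x z \<union> inside T z y)"
  then show "t \<in> inside T x y"
    using assms by (fastforce simp: inside_def)
qed

text \<open>The witness is the last neighbour of \<open>x\<close> before \<open>y\<close> (or \<open>x + 1\<close> if there is none).\<close>
lemma inside_split_no_triangle:
  assumes nc: "noncrossing T" and xy: "x + 1 < y"
    and none: "\<And>z. x < z \<Longrightarrow> z < y \<Longrightarrow> {x, z, y} \<notin> T"
  obtains z where "x < z" "z < y" "inside T x y \<subseteq> inside T x z \<union> inside T z y"
proof -
  define S where "S = {z. x < z \<and> z < y \<and> (\<exists>t\<in>inside T x y. x \<in> t \<and> z \<in> t)}"
  define z where "z = Max (insert (x + 1) S)"
  have finS: "finite S" unfolding S_def by (rule finite_subset[of _ "{..y}"]) auto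
  have zin: "z = x + 1 \<or> z \<in> S"
    using Max_in[of "insert (x + 1) S"] finS unfolding z_def by auto
  have zmax: "v \<le> z" if "v \<in> S" for v
    unfolding z_def using that finS by simp
  have z: "x < z" "z < y" using zin xy by (auto simp: S_def)
  have "inside T x y \<subseteq> inside T x z \<union> inside T z y"
  proof
    fix t assume t: "t \<in> inside T x y"
    then have tT: "t \<in> T" "t \<subseteq> {x..y}" by (auto simp: inside_def)
    \<comment> \<open>For \<open>z = x + 1\<close> nothing lies strictly between; otherwise some
      triangle has the side \<open>{x, z}\<close>, which no other triangle crosses.\<close>
    have av: "t \<subseteq> {x..z} \<or> t \<inter> {x<..<z} = {}"
    proof (cases "z = x + 1")
      case False
      then obtain s where "s \<in> T" "x \<in> s" "z \<in> s" using zin by (auto simp: S_def inside_def)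
      then show ?thesis using noncrossing_avoid[OF nc] tT by blast
    qed auto
    have "t \<subseteq> {z..y}" if avz: "t \<inter> {x<..<z} = {}"
    proof (cases "x \<in> t")
      case False
      show ?thesis
      proof
        fix v assume "v \<in> t"
        then have "x \<le> v" "v \<le> y" "v \<noteq> x" "\<not> (x < v \<and> v < z)"
          using avz tT(2) False by auto
        then show "v \<in> {z..y}" by auto
      qed
    next
      case True
      have "card t = 3" using nc tT by (auto simp: noncrossing_def)
      then obtain u v w where uvw: "u < v" "v < w" "t = {u, v, w}"
        by (rule card_3_nat_sorted)
      then have ux: "u = x" and wy: "w \<le> y" using True tT(2) by auto
      then have "v \<in> S" using uvw t True by (auto simp: S_def)
      then have "v \<le> z" by (rule zmax)
      moreover have "v \<ge> z" using avz uvw ux by auto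
      ultimately have vz: "v = z" by simp
      \<comment> \<open>A smaller \<open>w\<close> would be a neighbour of \<open>x\<close> beyond
        the last one. With \<open>w = y\<close> the triangle \<open>t\<close> stands on the chord
        \<open>{x, y}\<close>, which \<open>none\<close> excludes.\<close>
      have "w = y"
      proof (rule ccontr)
        assume "w \<noteq> y"
        then have "w \<in> S" using uvw wy ux t by (auto simp: S_def)
        then show False using zmax vz uvw by fastforce
      qed
      then show ?thesis using none[of z] z uvw ux vz tT by simp
    qed
    then show "t \<in> inside T x z \<union> inside T z y" using av tT by (auto simp: inside_def)
  qed
  then show thesis using that z by blast
qed

text \<open>Strong induction on \<open>y - x\<close>: an inner point \<open>z\<close> leaves at most
  \<open>(z - x - 1) + (y - z - 1) = y - x - 2\<close> triangles in the two halves, and only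
  \<open>{x, z, y}\<close> can come in addition.\<close>

lemma card_inside:
  assumes nc: "noncrossing T"
  shows "card (inside T x y) \<le> y - x - 1"
proof (induction "y - x" arbitrary: x y rule: less_induct)
  case less
  have fin: "finite (inside T u v)" for u v
    using nc by (simp add: finite_inside noncrossing_def)
  show ?case
  proof (cases "x + 1 < y")
    case False
    then show ?thesis using inside_short[OF nc] by simp
  next
    case True
    \<comment> \<open>Both kinds of splitting are weakened to one inclusion, in which
      \<open>{x, z, y}\<close> need not belong to \<open>T\<close>.\<close>
    have "\<exists>z. x < z \<and> z < y \<and> inside T x y \<subseteq> insert {x, z, y} (inside T x z \<union> inside T z y)"
      using inside_split_triangle[OF nc] inside_split_no_triangle[OF nc True]
      by (metis subset_insertI2 order_refl)
    then obtain z where z: "x < z" "z < y"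
      and sub: "inside T x y \<subseteq> insert {x, z, y} (inside T x z \<union> inside T z y)" by blast
    have "card (inside T x y) \<le> card (insert {x, z, y} (inside T x z \<union> inside T z y))"
      using sub fin by (intro card_mono) auto
    also have "\<dots> \<le> 1 + (card (inside T x z) + card (inside T z y))"
      using fin card_Un_le[of "inside T x z" "inside T z y"] by (simp add: card_insert_if)
    also have "\<dots> \<le> 1 + ((z - x - 1) + (y - z - 1))"
      using less[of z x] less[of y z] z by (intro add_mono order_refl) simp_all
    finally show ?thesis using z by linarith
  qed
qed

text \<open>Both halves obey the bound \<open>card_inside\<close>, and the total reaches its maximum
  only if both bounds are attained.\<close>

lemma full_split_triangle:
  assumes nc: "noncrossing T" and z: "{x, z, y} \<in> T" "x < z" "z < y"
    and full: "card (inside T x y) = y - x - 1"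
  shows "card (inside T x z) = z - x - 1" "card (inside T z y) = y - z - 1"
proof -
  have fin: "finite (inside T u v)" for u v
    using nc by (simp add: finite_inside noncrossing_def)
  have "card (inside T x y) \<le> Suc (card (inside T x z \<union> inside T z y))"
    unfolding inside_split_triangle[OF nc z] using fin by (simp add: card_insert_if)
  also have "\<dots> \<le> Suc (card (inside T x z) + card (inside T z y))"
    using card_Un_le by simp
  finally show "card (inside T x z) = z - x - 1" "card (inside T z y) = y - z - 1"
    using z full card_inside[OF nc, of x z] card_inside[OF nc, of z y] by linarith+
qed

text \<open>Without a triangle on the chord \<open>{x, y}\<close> the two halves hold at most
  \<open>y - x - 2\<close> triangles, one too few. So the count alone forces the existence of this
  triangle.\<close>

lemma full_interval_split:
  assumes nc: "noncrossing T" and xy: "x + 1 < y" and full: "card (inside T x y) = y - x - 1"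
  obtains z where "x < z" "z < y" "{x, z, y} \<in> T"
    "card (inside T x z) = z - x - 1" "card (inside T z y) = y - z - 1"
proof -
  have fin: "finite (inside T u v)" for u v
    using nc by (simp add: finite_inside noncrossing_def)
  have "\<exists>z. x < z \<and> z < y \<and> {x, z, y} \<in> T"
  proof (rule ccontr)
    assume "\<not> ?thesis"
    then obtain z where z: "x < z" "z < y" "inside T x y \<subseteq> inside T x z \<union> inside T z y"
      using inside_split_no_triangle[OF nc xy] by metis
    have "card (inside T x y) \<le> card (inside T x z \<union> inside T z y)"
      using z fin by (intro card_mono) auto
    also have "\<dots> \<le> (z - x - 1) + (y - z - 1)"
      using card_Un_le[of "inside T x z" "inside T z y"] card_inside[OF nc, of x z]
        card_inside[OF nc, of z y] by linarith
    finally show False using full z by linarith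
  qed
  then obtain z where z: "x < z" "z < y" "{x, z, y} \<in> T" by blast
  show thesis by (rule that[OF z]) (rule full_split_triangle[OF nc z(3,1,2) full])+
qed

section \<open>The parity of \<open>d\<close> in terms of squares and labels
  \<open>-1\<close>\<close>

text \<open>A square has either one negative label or two labels \<open>0\<close>, so it adds
  exactly \<open>1\<close> to \<open>d\<close>; outside the squares only the labels
  \<open>-1\<close> contribute. Hence \<open>d\<close> is the number of squares plus the number of
  labels \<open>-1\<close>.\<close>

lemma square_partition_card:
  assumes fin: "finite T" and sp: "square_partition T a P"
  shows "card T = 2 * card P + card {t \<in> T. a t = 1} + card {t \<in> T. a t = -1}"
    and "sign_even T a \<longleftrightarrow> even (card P + card {t \<in> T. a t = -1})"
proof -
  have sq: "\<exists>t1 t2. p = {t1, t2} \<and> t1 \<noteq> t2 \<and> a t1 = - a t2" if "p \<in> P" for p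
    using sp that unfolding square_partition_def by meson
  have dis: "p \<inter> q = {}" if "p \<in> P" "q \<in> P" "p \<noteq> q" for p q
    using sp that unfolding square_partition_def by blast
  have Un: "\<Union>P = {t \<in> T. a t \<notin> {1, -1}}"
    using sp unfolding square_partition_def by blast
  have finP: "finite P"
    by (rule finite_subset[of _ "Pow T"]) (use Un fin in auto)
  have finp: "finite p" if "p \<in> P" for p using sq[OF that] by auto
  \<comment> \<open>The predicate \<open>Q\<close> is left open: the count is needed for all labels,
    for the negative ones and for the zeros.\<close>
  have count: "card {t \<in> T. a t \<notin> {1, -1} \<and> Q t} = (\<Sum>p\<in>P. card {t \<in> p. Q t})" for Q
  proof -
    have "{t \<in> T. a t \<notin> {1, -1} \<and> Q t} = (\<Union>p\<in>P. {t \<in> p. Q t})"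
      using Un by blast
    also have "card \<dots> = (\<Sum>p\<in>P. card {t \<in> p. Q t})"
      by (rule card_UN_disjoint) (use finP finp dis in auto)
    finally show ?thesis .
  qed
  have "(\<Sum>p\<in>P. card {t \<in> p. True}) = (\<Sum>p\<in>P. 2)"
  proof (rule sum.cong)
    fix p assume "p \<in> P"
    then obtain t1 t2 where "p = {t1, t2}" "t1 \<noteq> t2" using sq by blast
    then show "card {t \<in> p. True} = 2" unfolding Collect_mem_eq simp_thms by simp
  qed simp
  then have all: "card {t \<in> T. a t \<notin> {1, -1}} = 2 * card P"
    using count[of "\<lambda>_. True"] by simp
  have "T = {t \<in> T. a t \<notin> {1, -1}} \<union> ({t \<in> T. a t = 1} \<union> {t \<in> T. a t = -1})" by blast
  then have "card T = card ({t \<in> T. a t \<notin> {1, -1}} \<union> ({t \<in> T. a t = 1} \<union> {t \<in> T. a t = -1}))"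
    by (rule arg_cong)
  also have "\<dots> = card {t \<in> T. a t \<notin> {1, -1}} + card ({t \<in> T. a t = 1} \<union> {t \<in> T. a t = -1})"
    by (rule card_Un_disjoint) (use fin in auto)
  also have "card ({t \<in> T. a t = 1} \<union> {t \<in> T. a t = -1})
      = card {t \<in> T. a t = 1} + card {t \<in> T. a t = -1}"
    by (rule card_Un_disjoint) (use fin in auto)
  finally show "card T = 2 * card P + card {t \<in> T. a t = 1} + card {t \<in> T. a t = -1}"
    using all by linarith
  define N where "N = card {t \<in> T. a t \<notin> {1, -1} \<and> a t < 0}"
  define Z where "Z = card {t \<in> T. a t \<notin> {1, -1} \<and> a t = 0}"
  \<comment> \<open>Twice the contribution to \<open>d\<close> is computed, which avoids halves of
    zeros.\<close>
  have per: "2 * card {t \<in> p. a t < 0} + card {t \<in> p. a t = 0} = 2"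
    "even (card {t \<in> p. a t = 0})" if p: "p \<in> P" for p
  proof -
    obtain t1 t2 where t: "p = {t1, t2}" "t1 \<noteq> t2" "a t1 = - a t2" using sq[OF p] by blast
    have cp: "card {t \<in> p. Q t} = (if Q t1 then 1 else 0) + (if Q t2 then 1 else 0)" for Q
    proof -
      have "{t \<in> p. Q t} = (if Q t1 then {t1} else {}) \<union> (if Q t2 then {t2} else {})"
        unfolding t(1) by auto
      then show ?thesis using t(2) by simp
    qed
    show "2 * card {t \<in> p. a t < 0} + card {t \<in> p. a t = 0} = 2"
      "even (card {t \<in> p. a t = 0})"
      unfolding cp using t(3) by auto
  qed
  have "2 * N + Z = (\<Sum>p\<in>P. 2 * card {t \<in> p. a t < 0} + card {t \<in> p. a t = 0})"
    unfolding N_def Z_def count by (simp add: sum.distrib sum_distrib_left)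
  also have "\<dots> = 2 * card P" using per by simp
  finally have NZ: "2 * N + Z = 2 * card P" .
  then have evenZ: "even Z" by presburger
  have Z: "card {t \<in> T. a t = 0} = Z" unfolding Z_def by (rule arg_cong[where f = card]) auto
  have "{t \<in> T. a t < 0} = {t \<in> T. a t \<notin> {1, -1} \<and> a t < 0} \<union> {t \<in> T. a t = -1}" by auto
  moreover have "card \<dots> = N + card {t \<in> T. a t = -1}"
    unfolding N_def by (rule card_Un_disjoint) (use fin in auto)
  ultimately have "card {t \<in> T. a t < 0} = N + card {t \<in> T. a t = -1}" by simp
  moreover have "N + Z div 2 = card P" using NZ evenZ by presburger
  ultimately show "sign_even T a \<longleftrightarrow> even (card P + card {t \<in> T. a t = -1})"
    unfolding sign_even_def Let_def Z using evenZ
    by (simp add: algebra_simps) presburger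
qed

section \<open>The tree of pieces below the side \<open>{0, m - 1}\<close>\<close>

locale labelled_polygon =
  fixes m :: nat and T :: "nat set set" and a :: "nat set \<Rightarrow> int" and P :: "nat set set set"
  assumes adm: "admissible_wrt {0..<m} T a P"
begin

lemma nc: "noncrossing T"
  using adm unfolding admissible_wrt_def is_triangulation_def noncrossing_def by simp

lemma
  shows finite_T: "finite T" and card_T: "card T = m - 2"
    and subset_V: "t \<in> T \<Longrightarrow> t \<subseteq> {0..<m}" and card_triangle: "t \<in> T \<Longrightarrow> card t = 3"
    and partition: "square_partition T a P" and even_sign: "sign_even T a"
  using adm unfolding admissible_wrt_def is_triangulation_def by simp_all

lemma square_cases:
  assumes "p \<in> P"
  obtains t1 t2 where "p = {t1, t2}" "t1 \<noteq> t2" "t1 \<in> T" "t2 \<in> T" "card (t1 \<inter> t2) = 2"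
    "a t1 = - a t2"
  using assms partition unfolding square_partition_def by meson

lemma squares_disjoint: "p \<in> P \<Longrightarrow> q \<in> P \<Longrightarrow> p \<noteq> q \<Longrightarrow> p \<inter> q = {}"
  using partition unfolding square_partition_def by blast

lemma Union_squares: "\<Union>P = {t \<in> T. a t \<notin> {1, -1}}"
  using partition unfolding square_partition_def by blast

text \<open>The count says that the triangles inside triangulate the polygon on
  \<open>{x..y}\<close>; the second condition says that vertices strictly between \<open>x\<close>
  and \<open>y\<close> belong to no other triangle. By truncated subtraction the degenerate interval
  \<open>{z..z}\<close> qualifies, as the middle child of a single triangle must.\<close>

definition full :: "nat \<Rightarrow> nat \<Rightarrow> bool" where
  "full x y \<longleftrightarrow> card (inside T x y) = y - x - 1 \<and>
     (\<forall>t\<in>T. t \<subseteq> {x..y} \<or> t \<inter> {x<..<y} = {})"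

text \<open>The chord \<open>{x, y}\<close> does not cut through a square.\<close>
definition sealed :: "nat \<Rightarrow> nat \<Rightarrow> bool" where
  "sealed x y \<longleftrightarrow> full x y \<and>
     (\<forall>p\<in>P. p \<subseteq> inside T x y \<or> p \<inter> inside T x y = {})"

text \<open>
  A piece below the chord \<open>{x, y}\<close>; \<open>w = z\<close> encodes a single triangle, so that triangles and squares
  both have the three child intervals \<open>{x..w}\<close>, \<open>{w..z}\<close> and \<open>{z..y}\<close>.
\<close>
definition piece :: "nat set set \<Rightarrow> nat \<Rightarrow> nat \<Rightarrow> nat \<Rightarrow> nat \<Rightarrow> bool" where
  "piece p x w z y \<longleftrightarrow> x < w \<and> w \<le> z \<and> z < y \<and> p \<subseteq> T \<and> \<Union>p = {x, w, z, y} \<and>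
     (if w = z then p = {{x, z, y}} \<and> a {x, z, y} \<in> {1, -1} else p \<in> P) \<and>
     inside T x y = p \<union> (inside T x w \<union> inside T w z \<union> inside T z y) \<and>
     p \<inter> (inside T x w \<union> inside T w z \<union> inside T z y) = {}"

lemma inside_subset: "x' \<le> x \<Longrightarrow> y \<le> y' \<Longrightarrow> inside T x y \<subseteq> inside T x' y'"
  by (auto simp: inside_def)

text \<open>The triangles of a square share two vertices, so a square cannot be spread over two
  consecutive intervals.\<close>

lemma inside_common_vertices:
  assumes "s \<in> inside T x y" "t \<in> inside T x' y'" "y \<le> x'"
  shows "card (s \<inter> t) \<le> 1"
proof -
  have "s \<inter> t \<subseteq> {y}" using assms by (force simp: inside_def)
  then show ?thesis using card_mono[of "{y}"] by simp
qed

lemma inside_disjoint: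
  assumes "y \<le> x'"
  shows "inside T x y \<inter> inside T x' y' = {}"
proof -
  have False if "s \<in> inside T x y" "s \<in> inside T x' y'" for s
    using inside_common_vertices[OF that assms] card_triangle[of s] that by (simp add: inside_def)
  then show ?thesis by blast
qed

text \<open>A square that meets a child interval lies below \<open>{x, y}\<close> and differs from
  \<open>p\<close>, so its other triangle lies in some child as well. Different children have at
  most one vertex in common, so it is the same child.\<close>

lemma piece_children_sealed:
  assumes "piece p x w z y" "sealed x y"
    and "full x w" "full w z" "full z y"
  shows "sealed x w" "sealed w z" "sealed z y"
proof -
  have pc: "x < w" "w \<le> z" "z < y"
    and ins: "inside T x y = p \<union> (inside T x w \<union> inside T w z \<union> inside T z y)"
    and dis: "p \<inter> (inside T x w \<union> inside T w z \<union> inside T z y) = {}"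
    using assms(1) unfolding piece_def by auto
  \<comment> \<open>Either \<open>p\<close> is itself a square of \<open>P\<close>, or it is a
    triangle labelled \<open>1\<close> or \<open>-1\<close>, which no square contains.\<close>
  have pP: "q = p \<or> q \<inter> p = {}" if "q \<in> P" for q
  proof (cases "w = z")
    case True
    then have "p = {{x, z, y}}" "a {x, z, y} \<in> {1, -1}"
      using assms(1) unfolding piece_def by auto
    moreover have "a t \<notin> {1, -1}" if "t \<in> q" for t
      using Union_squares that \<open>q \<in> P\<close> by blast
    ultimately show ?thesis by blast
  next
    case False
    then have "p \<in> P" using assms(1) unfolding piece_def by simp
    then show ?thesis using squares_disjoint that by blast
  qed
  have key: "q \<subseteq> inside T u v \<or> q \<inter> inside T u v = {}"
    if q: "q \<in> P" and uv: "(u, v) \<in> {(x, w), (w, z), (z, y)}" for q u v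
  proof (rule ccontr)
    assume n: "\<not> ?thesis"
    obtain t1 t2 where t: "q = {t1, t2}" "card (t1 \<inter> t2) = 2" using square_cases[OF q] by metis
    have "(t1 \<in> inside T u v) \<noteq> (t2 \<in> inside T u v)"
      using n unfolding t(1) by auto
    then obtain s1 s2 where s: "q = {s1, s2}" "card (s1 \<inter> s2) = 2"
      "s1 \<in> inside T u v" "s2 \<notin> inside T u v"
      using t that[of t1 t2] that[of t2 t1]
      by (cases "t1 \<in> inside T u v") (simp_all add: insert_commute Int_commute)
    have "inside T u v \<subseteq> inside T x y" using uv ins by auto
    moreover have sq: "s1 \<in> q" "s2 \<in> q" using s(1) by auto
    ultimately have "q \<subseteq> inside T x y" using assms(2) q s(3) unfolding sealed_def by blast
    moreover have "s1 \<notin> p" using dis uv s(3) by blast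
    then have "q \<inter> p = {}" using pP[OF q] sq by blast
    ultimately have "s2 \<in> inside T x w \<union> inside T w z \<union> inside T z y" using ins sq by blast
    then obtain u' v' where uv': "(u', v') \<in> {(x, w), (w, z), (z, y)}" "s2 \<in> inside T u' v'"
      by blast
    then have "(u', v') \<noteq> (u, v)" using s(4) by blast
    then have "v \<le> u' \<or> v' \<le> u" using uv uv'(1) pc by auto
    then show False
      using inside_common_vertices[of s1 u v s2 u' v'] inside_common_vertices[of s2 u' v' s1 u v] s uv'(2)
      by (auto simp: Int_commute)
  qed
  show "sealed x w" "sealed w z" "sealed z y"
    unfolding sealed_def using assms(3-5) key by auto
qed

lemma ordered_triangle_in:
  assumes "t \<in> T" "u \<in> t" "v \<in> t" "t \<subseteq> {u..v}" "u < v"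
  obtains w where "u < w" "w < v" "t = {u, w, v}"
proof -
  obtain x y z where xyz: "x < y" "y < z" "t = {x, y, z}"
    using card_3_nat_sorted card_triangle[OF assms(1)] by metis
  then have "x = u" "z = v" using assms by auto
  then show thesis using that xyz by auto
qed

text \<open>The triangle on the chord \<open>{x, y}\<close> is a piece by itself if its label is
  \<open>1\<close> or \<open>-1\<close>. Otherwise its partner also lies below the sealed chord,
  hence in one of the two halves, and both triangles form the piece. The children are full by one or
  two applications of \<open>full_split_triangle\<close>.\<close>

lemma sealed_decompose:
  assumes sl: "sealed x y" and xy: "x + 1 < y"
  obtains p w z where "piece p x w z y" "sealed x w" "sealed w z" "sealed z y"
proof -
  have full: "card (inside T x y) = y - x - 1" using sl by (simp add: sealed_def full_def)
  obtain z where z: "x < z" "z < y" "{x, z, y} \<in> T"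
    and c: "card (inside T x z) = z - x - 1" "card (inside T z y) = y - z - 1"
    using full_interval_split[OF nc xy full] by metis
  let ?t = "{x, z, y}"
  note sp = inside_split_triangle[OF nc z(3,1,2)]
  have tin: "?t \<in> inside T x y" using z by (auto simp: inside_def)
  have notin: "?t \<notin> inside T x z" "?t \<notin> inside T z y" using z by (auto simp: inside_def)
  note avt = noncrossing_avoid[OF nc z(3)]
  show thesis
  proof (cases "a ?t \<in> {1, -1}")
    case True
    have zz: "inside T z z = {}" using inside_short[OF nc] by simp
    have pc: "piece {?t} x z z y"
      unfolding piece_def using z True sp notin zz by auto
    have "full x z" "full z z" "full z y"
      unfolding full_def using c zz avt by auto
    then show thesis using that[OF pc] piece_children_sealed[OF pc sl] by blast
  next
    case False
    then obtain p where p: "p \<in> P" "?t \<in> p" using Union_squares z by blast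
    obtain t2 where t2: "p = {?t, t2}" "?t \<noteq> t2" "t2 \<in> T" "card (?t \<inter> t2) = 2"
    proof (rule square_cases[OF p(1)])
      fix s1 s2 assume s: "p = {s1, s2}" "s1 \<noteq> s2" "s1 \<in> T" "s2 \<in> T" "card (s1 \<inter> s2) = 2"
      then consider "?t = s1" | "?t = s2" using p(2) by blast
      then show thesis
      proof cases
        case 1
        show thesis by (rule that[of s2]) (use s 1 in simp_all)
      next
        case 2
        show thesis by (rule that[of s1]) (use s 2 in \<open>simp_all add: insert_commute Int_commute\<close>)
      qed
    qed
    have "p \<subseteq> inside T x y" using sl p tin unfolding sealed_def by blast
    then have "t2 \<in> insert ?t (inside T x z \<union> inside T z y)" unfolding sp t2(1) by simp
    then consider "t2 \<in> inside T x z" | "t2 \<in> inside T z y" using t2(2) by fastforce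
    then show thesis
    proof cases
      case 1
      \<comment> \<open>The common side can only be \<open>{x, z}\<close>, so the partner stands on
        it and contributes the fourth vertex \<open>w\<close>.\<close>
      have "?t \<inter> t2 \<subseteq> {x, z}" using 1 z by (auto simp: inside_def)
      then have "?t \<inter> t2 = {x, z}" using t2(4) z by (intro card_subset_eq) auto
      then obtain w where w: "x < w" "w < z" "t2 = {x, w, z}"
        using ordered_triangle_in[OF t2(3), of x z] 1 z unfolding inside_def by blast
      then have wT: "{x, w, z} \<in> T" using t2 by simp
      note sp2 = inside_split_triangle[OF nc wT w(1,2)]
      have n2: "t2 \<notin> inside T x w" "t2 \<notin> inside T w z" "t2 \<notin> inside T z y"
        "?t \<notin> inside T x w" "?t \<notin> inside T w z"
        using w z by (auto simp: inside_def)
      have pc: "piece p x w z y"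
        unfolding piece_def sp sp2 using w z n2 notin p(1) t2(1,3) by auto
      have c2: "card (inside T x w) = w - x - 1" "card (inside T w z) = z - w - 1"
        by (rule full_split_triangle[OF nc wT w(1,2)], rule c)+
      have "full x w" "full w z" "full z y"
        unfolding full_def using c c2 avt noncrossing_avoid[OF nc wT] by auto
      then show thesis using that[OF pc] piece_children_sealed[OF pc sl] by blast
    next
      case 2
      \<comment> \<open>In the mirror case the fourth vertex \<open>w\<close> lies to the right of
        \<open>z\<close>, so the inner vertices of the piece are \<open>z\<close>, \<open>w\<close>
        in this order.\<close>
      have "?t \<inter> t2 \<subseteq> {z, y}" using 2 z by (auto simp: inside_def)
      then have "?t \<inter> t2 = {z, y}" using t2(4) z by (intro card_subset_eq) auto
      then obtain w where w: "z < w" "w < y" "t2 = {z, w, y}"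
        using ordered_triangle_in[OF t2(3), of z y] 2 z unfolding inside_def by blast
      then have wT: "{z, w, y} \<in> T" using t2 by simp
      note sp2 = inside_split_triangle[OF nc wT w(1,2)]
      have n2: "t2 \<notin> inside T x z" "t2 \<notin> inside T z w" "t2 \<notin> inside T w y"
        "?t \<notin> inside T z w" "?t \<notin> inside T w y"
        using w z by (auto simp: inside_def)
      have pc: "piece p x z w y"
        unfolding piece_def sp sp2 using w z n2 notin p(1) t2(1,3) by auto
      have c2: "card (inside T z w) = w - z - 1" "card (inside T w y) = y - w - 1"
        by (rule full_split_triangle[OF nc wT w(1,2)], rule c)+
      have "full x z" "full z w" "full w y"
        unfolding full_def using c c2 avt noncrossing_avoid[OF nc wT] by auto
      then show thesis using that[OF pc] piece_children_sealed[OF pc sl] by blast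
    qed
  qed
qed

lemma sealed_whole: "sealed 0 (m - 1)"
proof -
  have "inside T 0 (m - 1) = T"
    using subset_V by (force simp: inside_def)
  moreover have "t \<subseteq> {0..m - 1}" if "t \<in> T" for t
    using subset_V[OF that] by force
  moreover have "p \<subseteq> T" if "p \<in> P" for p
    using Union_squares that by blast
  ultimately show ?thesis
    using card_T by (simp add: sealed_def full_def)
qed

section \<open>Leaves of the tree\<close>

text \<open>The vertices that disappear with the piece lie in no other triangle, so a smaller
  polygon remains. A square is described by its union because either diagonal of the quadrilateral
  may be present.\<close>

definition leaf :: "nat set set \<Rightarrow> bool" where
  "leaf p \<longleftrightarrow> p \<subseteq> T \<and> (\<exists>k<m.
     p = {tri m k} \<and> a (tri m k) \<in> {1, -1} \<and> (\<forall>t\<in>T - p. k \<notin> t) \<or>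
     p \<in> P \<and> \<Union>p = quad m k \<and> (\<forall>t\<in>T - p. k \<notin> t \<and> (k + 1) mod m \<notin> t))"

text \<open>Descend into a child interval that is longer than a side, by strong induction on
  \<open>y - x\<close>. If there is none, the piece is everything below the chord, and its inner
  vertices occur in no other triangle.\<close>

lemma sealed_leaf:
  assumes "sealed x y" "x + 1 < y" "y < m"
  shows "\<exists>p. leaf p \<and> p \<subseteq> inside T x y"
  using assms
proof (induction "y - x" arbitrary: x y rule: less_induct)
  case less
  obtain p w z where pc: "piece p x w z y" and sl: "sealed x w" "sealed w z" "sealed z y"
    using sealed_decompose less.prems by metis
  have ord: "x < w" "w \<le> z" "z < y" using pc unfolding piece_def by auto
  show ?case
  proof (cases "x + 1 < w \<or> w + 1 < z \<or> z + 1 < y")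
    case True
    then have "\<exists>u v. (u, v) \<in> {(x, w), (w, z), (z, y)} \<and> u + 1 < v" by blast
    then obtain u v where eq: "(u, v) \<in> {(x, w), (w, z), (z, y)}" and "u + 1 < v" by blast
    moreover from eq have "sealed u v" using sl by blast
    moreover from eq have "x \<le> u \<and> v \<le> y \<and> (x < u \<or> v < y)" using ord by auto
    ultimately have uv: "sealed u v" "u + 1 < v" "v < m" "v - u < y - x" "x \<le> u" "v \<le> y"
      using less.prems(3) by linarith+
    then obtain q where "leaf q" "q \<subseteq> inside T u v" using less.hyps by metis
    then show ?thesis using inside_subset uv by blast
  next
    case False
    then have eq: "w = x + 1" "y = z + 1" "z = w \<or> z = w + 1" using ord by auto
    have ins: "inside T x y = p"
      using pc inside_short[OF nc] eq unfolding piece_def by auto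
    have av: "t \<inter> {x<..<y} = {}" if "t \<in> T - p" for t
      using less.prems(1) that ins unfolding sealed_def full_def inside_def by blast
    have "leaf p"
      unfolding leaf_def
    proof (intro conjI exI[of _ w])
      show "p \<subseteq> T" using ins by (auto simp: inside_def)
      show "w < m" using ord less.prems by simp
      \<comment> \<open>No index wraps around since \<open>y < m\<close>; the corner to delete is
        \<open>w\<close>, and also \<open>w + 1\<close> for a square.\<close>
      have "(w + m - 1) mod m = x" "w mod m = w" "(w + 1) mod m = w + 1"
        using eq less.prems(3) by auto
      moreover have "z \<noteq> w \<Longrightarrow> (w + 2) mod m = w + 2" using eq less.prems(3) by auto
      ultimately have *: "tri m w = {x, w, w + 1}" "z \<noteq> w \<Longrightarrow> quad m w = {x, w, w + 1, w + 2}"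
        and sw: "(w + 1) mod m = w + 1"
        unfolding tri_def quad_def by simp_all
      have avw: "w \<notin> t" "z \<noteq> w \<Longrightarrow> w + 1 \<notin> t" if "t \<in> T - p" for t
        using av[OF that] eq by auto
      show "p = {tri m w} \<and> a (tri m w) \<in> {1, -1} \<and> (\<forall>t\<in>T - p. w \<notin> t) \<or>
         p \<in> P \<and> \<Union>p = quad m w \<and> (\<forall>t\<in>T - p. w \<notin> t \<and> (w + 1) mod m \<notin> t)"
      proof (cases "z = w")
        case True
        then have "p = {tri m w}" "a (tri m w) \<in> {1, -1}"
          using pc eq * unfolding piece_def by simp_all
        then show ?thesis using avw by blast
      next
        case False
        then have "p \<in> P" "\<Union>p = quad m w" using pc eq * unfolding piece_def by simp_all
        then show ?thesis using avw False sw by simp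
      qed
    qed
    then show ?thesis using ins by blast
  qed
qed

text \<open>The hypothesis \<open>short\<close> says that two of the three children hold no
  triangle. All the rest then hangs on one side of the root piece, which is therefore a leaf,
  possibly across the wraparound between \<open>m - 1\<close> and \<open>0\<close>.\<close>

lemma root_leaf:
  assumes pc: "piece p 0 w z (m - 1)" and m: "m \<ge> 4"
    and short: "w = 1 \<and> z \<le> w + 1 \<or> w = 1 \<and> z + 2 = m \<or> z \<le> w + 1 \<and> z + 2 = m"
  shows "leaf p"
proof -
  have ord: "0 < w" "w \<le> z" "z < m - 1" and pT: "p \<subseteq> T" and Up: "\<Union>p = {0, w, z, m - 1}"
    and kind: "w = z \<Longrightarrow> p = {{0, z, m - 1}} \<and> a {0, z, m - 1} \<in> {1, -1}"
      "w \<noteq> z \<Longrightarrow> p \<in> P"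
    and ins: "inside T 0 (m - 1) = p \<union> (inside T 0 w \<union> inside T w z \<union> inside T z (m - 1))"
    using pc unfolding piece_def by (auto split: if_splits)
  have "T \<subseteq> inside T 0 (m - 1)"
    using subset_V by (force simp: inside_def)
  then have rest: "t \<in> inside T 0 w \<union> inside T w z \<union> inside T z (m - 1)" if "t \<in> T - p" for t
    using ins that by blast
  have mods: "(0 + m - 1) mod m = m - 1" "0 mod m = 0" "(0 + 1) mod m = 1" "(0 + 2) mod m = 2"
    "(m - 1 + m - 1) mod m = m - 2" "(m - 1) mod m = m - 1" "(m - 1 + 1) mod m = 0"
    "(m - 1 + 2) mod m = 1"
    "(m - 2 + m - 1) mod m = m - 3" "(m - 2) mod m = m - 2" "(m - 2 + 1) mod m = m - 1"
    "(m - 2 + 2) mod m = 0"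
  proof -
    have "m - 2 + 2 = m" using m by simp
    then show "(m - 2 + 2) mod m = 0" by (simp only: mod_self)
    have "m - 1 + m - 1 = (m - 2) + m" "m - 1 + 2 = 1 + m" "m - 2 + m - 1 = (m - 3) + m"
      using m by auto
    then show "(m - 1 + m - 1) mod m = m - 2" "(m - 1 + 2) mod m = 1"
      "(m - 2 + m - 1) mod m = m - 3"
      using m by (simp_all only: mod_add_self2 mod_less)
    have "m - 2 + 1 = m - 1" using m by simp
    then show "(m - 2 + 1) mod m = m - 1" using m by (simp only: mod_less)
  qed (use m in auto)
  have corners: "tri m 0 = {m - 1, 0, 1}" "tri m (m - 1) = {m - 2, m - 1, 0}"
    "quad m 0 = {m - 1, 0, 1, 2}" "quad m (m - 1) = {m - 2, m - 1, 0, 1}"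
    "quad m (m - 2) = {m - 3, m - 2, m - 1, 0}"
    unfolding tri_def quad_def mods by simp_all
  have avoid_below: "k \<notin> t" if "t \<in> inside T u v" "k < u" for t u v k
    using that by (auto simp: inside_def)
  have avoid_above: "k \<notin> t" if "t \<in> inside T u v" "v < k" for t u v k
    using that by (auto simp: inside_def)
  have triI: "leaf p" if "k < m" "w = z" "{0, z, m - 1} = tri m k" "\<forall>t\<in>T - p. k \<notin> t" for k
    unfolding leaf_def using kind(1) pT that by auto
  have quadI: "leaf p" if "k < m" "w \<noteq> z" "{0, w, z, m - 1} = quad m k"
    "\<forall>t\<in>T - p. k \<notin> t \<and> (k + 1) mod m \<notin> t" for k
    unfolding leaf_def using kind(2) pT that Up by auto
  \<comment> \<open>Five shapes remain, by the kind of the piece and the child holding the rest; the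
    index \<open>k\<close> of the leaf is \<open>0\<close>, \<open>0\<close>, \<open>m - 1\<close>,
    \<open>m - 1\<close> and \<open>m - 2\<close>, respectively.\<close>
  have "w = 1 \<and> z = 1 \<or> w = 1 \<and> z = 2 \<or> w = 1 \<and> z + 2 = m \<and> z \<noteq> 1 \<or>
      w = z \<and> z + 2 = m \<or> w + 1 = z \<and> z + 2 = m"
    using short ord(1,2) by (elim disjE) linarith+
  then consider "w = 1" "z = 1" | "w = 1" "z = 2" | "w = 1" "z = m - 2" "z \<noteq> 1"
    | "w = m - 2" "z = m - 2" | "w = m - 3" "z = m - 2" "w \<noteq> z"
    by fastforce
  then show ?thesis
  proof cases
    case 1
    have "t \<in> inside T 1 (m - 1)" if "t \<in> T - p" for t
      using rest[OF that] 1 inside_short[OF nc] by auto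
    then show ?thesis
      by (intro triI[of 0]) (use 1 m corners avoid_below[of _ 1 "m - 1" 0] in auto)
  next
    case 2
    have "t \<in> inside T 2 (m - 1)" if "t \<in> T - p" for t
      using rest[OF that] 2 inside_short[OF nc] by auto
    then show ?thesis
      by (intro quadI[of 0], unfold mods corners)
        (use 2 m avoid_below[of _ 2 "m - 1" 0] avoid_below[of _ 2 "m - 1" 1] in auto)
  next
    case 3
    have "t \<in> inside T 1 (m - 2)" if "t \<in> T - p" for t
      using rest[OF that] 3 inside_short[OF nc] by auto
    then have "\<forall>t\<in>T - p. m - 1 \<notin> t \<and> 0 \<notin> t"
      using avoid_below[of _ 1 "m - 2" 0] avoid_above[of _ 1 "m - 2" "m - 1"] m by auto
    then show ?thesis
      by (intro quadI[of "m - 1"], unfold mods corners) (use 3 m in auto)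
  next
    case 4
    have "t \<in> inside T 0 (m - 2)" if "t \<in> T - p" for t
      using rest[OF that] 4 inside_short[OF nc] by auto
    then have "\<forall>t\<in>T - p. m - 1 \<notin> t"
      using avoid_above[of _ 0 "m - 2" "m - 1"] m by auto
    then show ?thesis
      by (intro triI[of "m - 1"], unfold corners) (use 4 m in auto)
  next
    case 5
    have "t \<in> inside T 0 (m - 3)" if "t \<in> T - p" for t
      using rest[OF that] 5 inside_short[OF nc] by auto
    then have "\<forall>t\<in>T - p. m - 2 \<notin> t \<and> m - 1 \<notin> t"
      using avoid_above[of _ 0 "m - 3" "m - 1"] avoid_above[of _ 0 "m - 3" "m - 2"] m by auto
    then show ?thesis
      by (intro quadI[of "m - 2"], unfold mods corners) (use 5 m in auto)
  qed
qed

text \<open>In that case there is one square and no label \<open>-1\<close>, so \<open>d = 1\<close>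
  is odd.\<close>

lemma not_single_square:
  assumes "p \<in> P"
  shows "T \<noteq> p"
proof
  assume T: "T = p"
  have "q = p" if q: "q \<in> P" for q
  proof (rule ccontr)
    assume "q \<noteq> p"
    moreover have "q \<subseteq> p" using Union_squares q T by blast
    moreover have "q \<noteq> {}" using square_cases[OF q] by blast
    ultimately show False using squares_disjoint[OF q assms] by blast
  qed
  then have "P = {p}" using assms by blast
  moreover have "{t \<in> T. a t = -1} = {}" using Union_squares T assms by blast
  then have "card {t \<in> T. a t = -1} = 0" by (simp only: card.empty)
  ultimately show False
    using square_partition_card(2)[OF finite_T partition] even_sign by simp
qed

text \<open>If two children of the root piece hold triangles, each contains a leaf. If only one
  does, the root piece is the second leaf. If none does, \<open>T\<close> is a single piece, which
  is no triangle since \<open>m\<close> is at least \<open>4\<close> and no square by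
  parity.\<close>

lemma two_leaves:
  assumes m: "m \<ge> 4"
  shows "\<exists>p q. leaf p \<and> leaf q \<and> p \<inter> q = {}"
proof -
  obtain p w z where pc: "piece p 0 w z (m - 1)"
    and sl: "sealed 0 w" "sealed w z" "sealed z (m - 1)"
    by (rule sealed_decompose[OF sealed_whole]) (use m in auto)
  have ord: "0 < w" "w \<le> z" "z < m - 1"
    and ins: "inside T 0 (m - 1) = p \<union> (inside T 0 w \<union> inside T w z \<union> inside T z (m - 1))"
    and dis: "p \<inter> (inside T 0 w \<union> inside T w z \<union> inside T z (m - 1)) = {}"
    using pc unfolding piece_def by auto
  have lf: "\<exists>q. leaf q \<and> q \<subseteq> inside T u v"
    if "(u, v) \<in> {(0, w), (w, z), (z, m - 1)}" "u + 1 < v" for u v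
    using sealed_leaf[of u v] that sl ord by auto
  have two: ?thesis
    if "(u, v) \<in> {(0, w), (w, z), (z, m - 1)}" "u + 1 < v"
      "(u', v') \<in> {(0, w), (w, z), (z, m - 1)}" "u' + 1 < v'" "v \<le> u'" for u v u' v'
    using lf[OF that(1,2)] lf[OF that(3,4)] inside_disjoint[OF that(5), of u v'] by blast
  have one: ?thesis
    if "(u, v) \<in> {(0, w), (w, z), (z, m - 1)}" "u + 1 < v" "leaf p" for u v
    using lf[OF that(1,2)] dis that(1,3) by blast
  consider (none) "w = 1" "z \<le> w + 1" "z + 2 = m"
    | (third) "w = 1" "z \<le> w + 1" "z + 1 < m - 1"
    | (second) "w = 1" "w + 1 < z" "z + 2 = m"
    | (first) "0 + 1 < w" "z \<le> w + 1" "z + 2 = m"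
    | (b12) "0 + 1 < w" "w + 1 < z"
    | (b13) "0 + 1 < w" "z + 1 < m - 1"
    | (b23) "w + 1 < z" "z + 1 < m - 1"
    using ord by linarith
  then show ?thesis
  proof cases
    case none
    then have "w \<noteq> z" using m by auto
    then have "p \<in> P" using pc unfolding piece_def by simp
    moreover have "inside T 0 (m - 1) = p"
      using ins none inside_short[OF nc] by auto
    moreover have "inside T 0 (m - 1) = T"
      using subset_V by (force simp: inside_def)
    ultimately show ?thesis using not_single_square by blast
  next
    case third
    then show ?thesis using one[of z "m - 1"] root_leaf[OF pc m] by simp
  next
    case second
    then show ?thesis using one[of w z] root_leaf[OF pc m] by simp
  next
    case first
    then show ?thesis using one[of 0 w] root_leaf[OF pc m] by simp
  next
    case b12
    then show ?thesis using two[of 0 w w z] by simp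
  next
    case b13
    then show ?thesis using two[of 0 w z "m - 1"] ord by simp
  next
    case b23
    then show ?thesis using two[of w z z "m - 1"] by simp
  qed
qed

end

section \<open>Removing leaves and keeping the sign even\<close>

lemma square_partition_uminus:
  assumes "square_partition T a P"
  shows "square_partition T (\<lambda>t. - a t) P"
proof -
  have "{t \<in> T. - a t \<notin> {1, -1}} = {t \<in> T. a t \<notin> {1, -1}}" by auto
  moreover have "- a t1 = - (- a t2) \<longleftrightarrow> a t1 = - a t2" for t1 t2 by auto
  ultimately show ?thesis using assms unfolding square_partition_def by presburger
qed

text \<open>Squares are pairwise disjoint and contain no label \<open>1\<close> or
  \<open>-1\<close>, so the removed triangles never break up a remaining square.\<close>

lemma square_partition_remove:
  assumes "square_partition T a P" "Q \<subseteq> P" "S \<subseteq> {t \<in> T. a t \<in> {1, -1}}"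
  shows "square_partition (T - (\<Union>Q \<union> S)) a (P - Q)"
proof -
  have sq: "\<exists>t1 t2. p = {t1, t2} \<and> t1 \<noteq> t2 \<and> t1 \<in> T \<and> t2 \<in> T \<and> card (t1 \<inter> t2) = 2 \<and> a t1 = - a t2"
    if "p \<in> P" for p
    using assms(1) that unfolding square_partition_def by meson
  have dis: "p \<inter> q = {}" if "p \<in> P" "q \<in> P" "p \<noteq> q" for p q
    using assms(1) that unfolding square_partition_def by blast
  have Un: "\<Union>P = {t \<in> T. a t \<notin> {1, -1}}"
    using assms(1) unfolding square_partition_def by blast
  have avoid: "p \<inter> (\<Union>Q \<union> S) = {}" if "p \<in> P - Q" for p
  proof -
    have "p \<inter> \<Union>Q = {}" using dis that assms(2) by blast
    moreover have "p \<inter> S = {}" using Un that assms(3) by blast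
    ultimately show ?thesis by blast
  qed
  have "\<exists>t1 t2. p = {t1, t2} \<and> t1 \<noteq> t2 \<and> t1 \<in> T - (\<Union>Q \<union> S) \<and> t2 \<in> T - (\<Union>Q \<union> S) \<and>
      card (t1 \<inter> t2) = 2 \<and> a t1 = - a t2" if p: "p \<in> P - Q" for p
  proof -
    obtain t1 t2 where "p = {t1, t2}" "t1 \<noteq> t2" "t1 \<in> T" "t2 \<in> T" "card (t1 \<inter> t2) = 2"
      "a t1 = - a t2" using sq p by blast
    moreover from this have "t1 \<notin> \<Union>Q \<union> S" "t2 \<notin> \<Union>Q \<union> S" using avoid[OF p] by simp_all
    ultimately show ?thesis by (intro exI[of _ t1] exI[of _ t2]) simp
  qed
  moreover have "\<Union>(P - Q) = {t \<in> T - (\<Union>Q \<union> S). a t \<notin> {1, -1}}"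
  proof (intro equalityI subsetI)
    fix t assume "t \<in> \<Union>(P - Q)"
    then obtain p where p: "p \<in> P - Q" "t \<in> p" by blast
    then have "t \<in> T" "a t \<notin> {1, -1}" using Un by blast+
    then show "t \<in> {t \<in> T - (\<Union>Q \<union> S). a t \<notin> {1, -1}}" using p(2) avoid[OF p(1)] by blast
  next
    fix t assume "t \<in> {t \<in> T - (\<Union>Q \<union> S). a t \<notin> {1, -1}}"
    then have "t \<in> \<Union>P" "t \<notin> \<Union>Q" unfolding Un by blast+
    then show "t \<in> \<Union>(P - Q)" by blast
  qed
  moreover have "\<forall>p\<in>P - Q. \<forall>q\<in>P - Q. p \<noteq> q \<longrightarrow> p \<inter> q = {}" using dis by blast
  ultimately show ?thesis unfolding square_partition_def by simp
qed

text \<open>Common core of all removals: \<open>R\<close> is the set of removed triangles,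
  \<open>K\<close> that of deleted vertices, and \<open>b\<close> will be \<open>a\<close> or its
  negative. Equal cardinalities of \<open>R\<close> and \<open>K\<close> preserve the number of
  triangles required of a triangulation, and \<open>ev\<close> is the new parity in the form given
  by \<open>square_partition_card\<close>.\<close>

lemma admissible_remove:
  assumes "is_triangulation V T" "square_partition T b P"
    and "Q \<subseteq> P" "S \<subseteq> {t \<in> T. b t \<in> {1, -1}}" "R = \<Union>Q \<union> S"
    and "K \<subseteq> V" "card R = card K" "card K + 2 \<le> card V"
    and avoid: "\<And>t. t \<in> T - R \<Longrightarrow> t \<inter> K = {}"
    and ev: "even (card (P - Q) + card ({t \<in> T. b t = -1} - S))"
  shows "admissible (V - K) (T - R) b"
proof -
  have fin: "finite V" "finite T" and cT: "card T = card V - 2"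
    and sub: "\<And>t. t \<in> T \<Longrightarrow> t \<subseteq> V"
    using assms(1) unfolding is_triangulation_def by auto
  have Un: "\<Union>P = {t \<in> T. b t \<notin> {1, -1}}"
    using assms(2) unfolding square_partition_def by blast
  have RT: "R \<subseteq> T" using Un assms(3-5) by blast
  have cV: "card (V - K) = card V - card K"
    using fin assms(6) by (simp add: card_Diff_subset finite_subset)
  have cTR: "card (T - R) = card T - card R"
    using fin RT by (simp add: card_Diff_subset finite_subset)
  have "t \<subseteq> V - K" if "t \<in> T - R" for t
    using avoid[OF that] sub that by blast
  then have "is_triangulation (V - K) (T - R)"
    using assms(1,7,8) cV cTR cT unfolding is_triangulation_def by auto
  moreover have sp: "square_partition (T - R) b (P - Q)"
    unfolding assms(5) by (rule square_partition_remove) fact+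
  moreover have "{t \<in> T - R. b t = -1} = {t \<in> T. b t = -1} - S"
    using Un assms(3,5) by blast
  then have "sign_even (T - R) b"
    using square_partition_card(2)[OF _ sp] fin ev by simp
  ultimately show ?thesis unfolding admissible_def admissible_wrt_def by blast
qed

context labelled_polygon
begin

lemma leaf_cases:
  assumes "leaf p"
  obtains (tri) k where "k < m" "p = {tri m k}" "tri m k \<in> T" "a (tri m k) = 1 \<or> a (tri m k) = -1"
      "\<And>t. t \<in> T - p \<Longrightarrow> k \<notin> t"
    | (quad) k t1 t2 where "k < m" "p = {t1, t2}" "t1 \<noteq> t2" "p \<in> P" "p \<subseteq> T" "t1 \<union> t2 = quad m k"
      "\<And>t. t \<in> T - p \<Longrightarrow> k \<notin> t \<and> (k + 1) mod m \<notin> t"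
proof -
  obtain k where k: "k < m" and pT: "p \<subseteq> T" and
    "p = {tri m k} \<and> a (tri m k) \<in> {1, -1} \<and> (\<forall>t\<in>T - p. k \<notin> t) \<or>
     p \<in> P \<and> \<Union>p = quad m k \<and> (\<forall>t\<in>T - p. k \<notin> t \<and> (k + 1) mod m \<notin> t)"
    using assms unfolding leaf_def by blast
  then consider "p = {tri m k}" "a (tri m k) \<in> {1, -1}" "\<forall>t\<in>T - p. k \<notin> t"
    | "p \<in> P" "\<Union>p = quad m k" "\<forall>t\<in>T - p. k \<notin> t \<and> (k + 1) mod m \<notin> t"
    by blast
  then show thesis
  proof cases
    case 1
    show thesis by (rule tri[OF k]) (use 1 pT in auto)
  next
    case 2
    obtain t1 t2 where t: "p = {t1, t2}" "t1 \<noteq> t2" using square_cases[OF 2(1)] by metis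
    show thesis by (rule quad[OF k t 2(1) pT]) (use 2 t in auto)
  qed
qed

lemma triangulation: "is_triangulation {0..<m} T"
  using adm unfolding admissible_wrt_def by blast

lemma finite_P: "finite P"
  by (rule finite_subset[of _ "Pow T"]) (use Union_squares finite_T in auto)

text \<open>The second identity ties the parity of \<open>m\<close> to the labels \<open>1\<close>
  and \<open>-1\<close>, whose roles are exchanged when all signs are changed.\<close>

lemma parity:
  "even (card P + card {t \<in> T. a t = -1})"
  "m - 2 = 2 * card P + card {t \<in> T. a t = 1} + card {t \<in> T. a t = -1}"
  using square_partition_card[OF finite_T partition] even_sign card_T by auto

lemma remove_positive_triangle:
  assumes "k < m" "tri m k \<in> T" "a (tri m k) = 1" "m \<ge> 3"
    and "\<And>t. t \<in> T - {tri m k} \<Longrightarrow> k \<notin> t"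
  shows "admissible ({0..<m} - {k}) (T - {tri m k}) a"
proof (rule admissible_remove[OF triangulation partition, of "{}" "{tri m k}"])
  have "{t \<in> T. a t = -1} - {tri m k} = {t \<in> T. a t = -1}" using assms(3) by auto
  then show "even (card (P - {}) + card ({t \<in> T. a t = -1} - {tri m k}))"
    using parity(1) by simp
qed (use assms in auto)

text \<open>After the sign change the labels \<open>-1\<close> are the former labels
  \<open>1\<close>. For even \<open>m\<close> there are as many of both kinds modulo
  \<open>2\<close>, so the parity condition carries over; the removed triangle is not among those
  counted.\<close>

lemma remove_negative_triangle:
  assumes "k < m" "tri m k \<in> T" "a (tri m k) = -1" "m \<ge> 3" "even m"
    and "\<And>t. t \<in> T - {tri m k} \<Longrightarrow> k \<notin> t"
  shows "admissible ({0..<m} - {k}) (T - {tri m k}) (\<lambda>t. - a t)"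
proof (rule admissible_remove[OF triangulation square_partition_uminus[OF partition],
      of "{}" "{tri m k}"])
  have "{t \<in> T. - a t = -1} - {tri m k} = {t \<in> T. a t = 1}" using assms(3) by auto
  moreover have "even (card P + card {t \<in> T. a t = 1})"
    using parity assms(4,5) by presburger
  ultimately show "even (card (P - {}) + card ({t \<in> T. - a t = -1} - {tri m k}))"
    by simp
qed (use assms in auto)

lemma remove_two_negative_triangles:
  assumes "j < m" "tri m j \<in> T" "a (tri m j) = -1" "k < m" "tri m k \<in> T" "a (tri m k) = -1"
    and "m \<ge> 4" "tri m j \<noteq> tri m k" "j \<noteq> k"
    and "\<And>t. t \<in> T - {tri m j, tri m k} \<Longrightarrow> j \<notin> t \<and> k \<notin> t"
  shows "admissible ({0..<m} - {j, k}) (T - {tri m j, tri m k}) a"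
proof (rule admissible_remove[OF triangulation partition, of "{}" "{tri m j, tri m k}"])
  have sub: "{tri m j, tri m k} \<subseteq> {t \<in> T. a t = -1}" using assms by auto
  have c: "card {tri m j, tri m k} = 2" using assms(8) by simp
  have "2 \<le> card {t \<in> T. a t = -1}"
    using card_mono[OF _ sub] finite_T c by simp
  moreover have "card ({t \<in> T. a t = -1} - {tri m j, tri m k}) = card {t \<in> T. a t = -1} - 2"
    using card_Diff_subset[OF _ sub] c by simp
  ultimately show "even (card (P - {}) + card ({t \<in> T. a t = -1} - {tri m j, tri m k}))"
    using parity(1) by simp
qed (use assms in auto)

text \<open>For odd \<open>m\<close> the numbers of labels \<open>1\<close> and \<open>-1\<close>
  differ in parity, so the sign change makes \<open>d\<close> odd, and the loss of one square makes
  it even again.\<close>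

lemma remove_square:
  assumes "k < m" "{t1, t2} \<in> P" "t1 \<noteq> t2" "{t1, t2} \<subseteq> T" "odd m" "m \<ge> 4"
    and "\<And>t. t \<in> T - {t1, t2} \<Longrightarrow> k \<notin> t \<and> (k + 1) mod m \<notin> t"
  shows "admissible ({0..<m} - {k, (k + 1) mod m}) (T - {t1, t2}) (\<lambda>t. - a t)"
proof (rule admissible_remove[OF triangulation square_partition_uminus[OF partition],
      of "{{t1, t2}}" "{}"])
  have "k \<noteq> (k + 1) mod m" using assms(1,6) by (auto simp: mod_Suc)
  then show "card {t1, t2} = card {k, (k + 1) mod m}" using assms(3) by simp
  then show "card {k, (k + 1) mod m} + 2 \<le> card {0..<m}" using assms(3,6) by simp
  have "card (P - {{t1, t2}}) = card P - 1" using assms(2) finite_P by simp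
  moreover have "card P > 0" using assms(2) finite_P by (auto simp: card_gt_0_iff)
  moreover have "even (card P - 1 + card {t \<in> T. a t = 1})"
    using parity assms(5,6) \<open>card P > 0\<close> by presburger
  ultimately show "even (card (P - {{t1, t2}}) + card ({t \<in> T. - a t = -1} - {}))"
    by simp
qed (use assms in auto)

lemma remove_two_squares:
  assumes "j < m" "{s1, s2} \<in> P" "s1 \<noteq> s2" "{s1, s2} \<subseteq> T"
    and "k < m" "{t1, t2} \<in> P" "t1 \<noteq> t2" "{t1, t2} \<subseteq> T"
    and dis: "{s1, s2} \<inter> {t1, t2} = {}"
    and far: "cyc_far m j k" "(j + 1) mod m \<noteq> (k + 1) mod m"
    and "\<And>t. t \<in> T - {s1, s2, t1, t2} \<Longrightarrow>
      j \<notin> t \<and> (j + 1) mod m \<notin> t \<and> k \<notin> t \<and> (k + 1) mod m \<notin> t"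
  shows "admissible ({0..<m} - {j, (j + 1) mod m, k, (k + 1) mod m}) (T - {s1, s2, t1, t2}) a"
proof (rule admissible_remove[OF triangulation partition, of "{{s1, s2}, {t1, t2}}" "{}"])
  have s: "s1 \<notin> {s2, t1, t2}" "s2 \<notin> {t1, t2}" using dis assms(3) by blast+
  then have cR: "card {s1, s2, t1, t2} = 4" using assms(7) by simp
  have "card {s1, s2, t1, t2} \<le> card T"
    using assms(4,8) finite_T by (intro card_mono) auto
  \<comment> \<open>Two disjoint squares consist of four triangles; this also leaves at least two
    vertices after the deletion.\<close>
  then have m: "m \<ge> 6" using cR card_T by simp
  have "j \<noteq> (j + 1) mod m" "k \<noteq> (k + 1) mod m" using assms(1,5) m by (auto simp: mod_Suc)
  then have cK: "card {j, (j + 1) mod m, k, (k + 1) mod m} = 4"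
    using far assms(1,5) by (auto simp: cyc_far_def)
  show "card {s1, s2, t1, t2} = card {j, (j + 1) mod m, k, (k + 1) mod m}"
    using cR cK by simp
  show "card {j, (j + 1) mod m, k, (k + 1) mod m} + 2 \<le> card {0..<m}" using cK m by simp
  have sub: "{{s1, s2}, {t1, t2}} \<subseteq> P" using assms(2,6) by simp
  have "{s1, s2} \<noteq> {t1, t2}" using s by (metis insertCI)
  then have c: "card {{s1, s2}, {t1, t2}} = 2" by simp
  have "card (P - {{s1, s2}, {t1, t2}}) = card P - 2"
    using card_Diff_subset[OF _ sub] c by simp
  moreover have "2 \<le> card P" using card_mono[OF finite_P sub] c by simp
  ultimately show "even (card (P - {{s1, s2}, {t1, t2}}) + card ({t \<in> T. a t = -1} - {}))"
    using parity(1) by simp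
next
  show "{s1, s2, t1, t2} = \<Union>{{s1, s2}, {t1, t2}} \<union> {}" by auto
  show "{j, (j + 1) mod m, k, (k + 1) mod m} \<subseteq> {0..<m}" using assms(1,5) by auto
  show "t \<inter> {j, (j + 1) mod m, k, (k + 1) mod m} = {}" if "t \<in> T - {s1, s2, t1, t2}" for t
    using assms(12)[OF that] by simp
qed (use assms(2,6) in simp_all)

text \<open>For \<open>m = 3\<close> a single triangle leaves no room for a square, and the label
  \<open>-1\<close> would make \<open>d\<close> odd.\<close>

lemma small_polygon:
  assumes "m < 4" "m \<ge> 2"
  shows "T = {} \<or> (\<exists>t. T = {t} \<and> a t = 1)"
proof (cases "m = 2")
  case True
  then show ?thesis using card_T finite_T by simp
next
  case False
  then have "card T = 1" and m: "m = 3" using card_T assms by auto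
  then obtain t where t: "T = {t}" by (auto simp: card_1_singleton_iff)
  have "card P = 0" using parity(2) m by simp
  then have "P = {}" using finite_P by simp
  then have "a t = 1 \<or> a t = -1" using Union_squares t by auto
  moreover have "a t \<noteq> -1"
  proof
    assume "a t = -1"
    then have "{s \<in> T. a s = -1} = {t}" using t by auto
    then show False using parity(1) \<open>card P = 0\<close> by simp
  qed
  ultimately show ?thesis using t by blast
qed

end

section \<open>Case distinction on the kinds of the two leaves\<close>

theorem theorem7p6:
  fixes m :: nat and T :: "nat set set" and a :: "nat set \<Rightarrow> int" and P :: "nat set set set"
  assumes "m \<ge> 2"
    and "admissible_wrt {0..<m} T a P"
  shows "(m < 4 \<and> (T = {} \<or> (\<exists>t. T = {t} \<and> a t = 1)))
    \<or> (\<exists>k<m. tri m k \<in> T \<and> a (tri m k) = 1 \<and>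
          admissible ({0..<m} - {k}) (T - {tri m k}) a)
    \<or> (odd m \<and> (\<exists>k<m. \<exists>t1 t2. {t1, t2} \<in> P \<and> t1 \<union> t2 = quad m k \<and>
          admissible ({0..<m} - {k, (k + 1) mod m}) (T - {t1, t2}) (\<lambda>t. - a t)))
    \<or> (even m \<and> (\<exists>k<m. tri m k \<in> T \<and> a (tri m k) = -1 \<and>
          admissible ({0..<m} - {k}) (T - {tri m k}) (\<lambda>t. - a t)))
    \<or> (\<exists>j<m. \<exists>k<m. cyc_far m j k \<and> (\<exists>s1 s2 t1 t2.
          {s1, s2} \<in> P \<and> s1 \<union> s2 = quad m j \<and> {t1, t2} \<in> P \<and> t1 \<union> t2 = quad m k \<and>
          admissible ({0..<m} - {j, (j + 1) mod m, k, (k + 1) mod m}) (T - {s1, s2, t1, t2}) a))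
    \<or> (\<exists>j<m. \<exists>k<m. cyc_far m j k \<and> tri m j \<in> T \<and> a (tri m j) = -1 \<and>
          tri m k \<in> T \<and> a (tri m k) = -1 \<and>
          admissible ({0..<m} - {j, k}) (T - {tri m j, tri m k}) a)"
    (is "?C0 \<or> ?C1 \<or> ?C2 \<or> ?C3 \<or> ?C4 \<or> ?C5")
proof (cases "m < 4")
  case True
  interpret labelled_polygon m T a P by unfold_locales (rule assms(2))
  show ?thesis using small_polygon[OF True assms(1)] True by blast
next
  case False
  interpret labelled_polygon m T a P by unfold_locales (rule assms(2))
  have m: "m \<ge> 4" using False by simp
  \<comment> \<open>The parity of \<open>m\<close> decides which of the two leaves goes: the
    triangle for even \<open>m\<close>, the square for odd \<open>m\<close>.\<close>
  have mixed: "?C2 \<or> ?C3"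
    if p: "j < m" "p = {tri m j}" "tri m j \<in> T" "a (tri m j) = -1" "\<And>t. t \<in> T - p \<Longrightarrow> j \<notin> t"
    and q: "k < m" "q = {t1, t2}" "t1 \<noteq> t2" "q \<in> P" "q \<subseteq> T" "t1 \<union> t2 = quad m k"
      "\<And>t. t \<in> T - q \<Longrightarrow> k \<notin> t \<and> (k + 1) mod m \<notin> t" for p q j k t1 t2
  proof (cases "even m")
    case True
    have "admissible ({0..<m} - {j}) (T - {tri m j}) (\<lambda>t. - a t)"
      by (rule remove_negative_triangle) (use p m True in auto)
    then have ?C3 using True p by blast
    then show ?thesis by blast
  next
    case False
    have "admissible ({0..<m} - {k, (k + 1) mod m}) (T - {t1, t2}) (\<lambda>t. - a t)"
      by (rule remove_square) (use q m False in auto)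
    moreover have "{t1, t2} \<in> P" using q(2,4) by simp
    ultimately have ?C2 using False q(1,6) by blast
    then show ?thesis by blast
  qed
  have positive: ?C1
    if "j < m" "p = {tri m j}" "tri m j \<in> T" "a (tri m j) = 1" "\<And>t. t \<in> T - p \<Longrightarrow> j \<notin> t" for p j
  proof -
    have "admissible ({0..<m} - {j}) (T - {tri m j}) a"
      by (rule remove_positive_triangle) (use that m in auto)
    then show ?thesis using that by blast
  qed
  obtain p q where p: "leaf p" and q: "leaf q" and pq: "p \<inter> q = {}"
    using two_leaves[OF m] by blast
  from p show ?thesis
  proof (cases rule: leaf_cases)
    case p: (tri j)
    show ?thesis
    proof (cases "a (tri m j) = 1")
      case True
      then have ?C1 using positive p by blast
      then show ?thesis by blast
    next
      case False
      then have aj: "a (tri m j) = -1" using p(4) by simp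
      from q show ?thesis
      proof (cases rule: leaf_cases)
        case q: (tri k)
        show ?thesis
        proof (cases "a (tri m k) = 1")
          case True
          then have ?C1 using positive q by blast
          then show ?thesis by blast
        next
          case False
          then have ak: "a (tri m k) = -1" using q(4) by simp
          \<comment> \<open>The corner of a leaf lies in no triangle of the other leaf, while each
            leaf contains its own corner and the next vertex. This separates \<open>j\<close> and
            \<open>k\<close> cyclically.\<close>
          have "j \<notin> tri m k" "k \<notin> tri m j" using p q pq by auto
          moreover have "j \<in> tri m j" "(j + 1) mod m \<in> tri m j" "k \<in> tri m k"
            "(k + 1) mod m \<in> tri m k"
            using p(1) q(1) by (auto simp: tri_def)
          ultimately have ne: "j \<noteq> k" "(j + 1) mod m \<noteq> k" "(k + 1) mod m \<noteq> j" "tri m j \<noteq> tri m k"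
            by metis+
          then have far: "cyc_far m j k" using p(1) q(1) by (simp add: cyc_far_def)
          have "admissible ({0..<m} - {j, k}) (T - {tri m j, tri m k}) a"
            by (rule remove_two_negative_triangles) (use p q aj ak m ne in auto)
          then have ?C5 using p(1,3) q(1,3) aj ak far by blast
          then show ?thesis by blast
        qed
      next
        case q: (quad k t1 t2)
        have "?C2 \<or> ?C3" by (rule mixed[OF p(1,2,3) aj p(5) q])
        then show ?thesis by blast
      qed
    qed
  next
    case p: (quad j s1 s2)
    from q show ?thesis
    proof (cases rule: leaf_cases)
      case q: (tri k)
      show ?thesis
      proof (cases "a (tri m k) = 1")
        case True
        then have ?C1 using positive q by blast
        then show ?thesis by blast
      next
        case False
        then have ak: "a (tri m k) = -1" using q(4) by simp
        have "?C2 \<or> ?C3" by (rule mixed[OF q(1,2,3) ak q(5) p])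
        then show ?thesis by blast
      qed
    next
      case q: (quad k t1 t2)
      have tp: "t1 \<in> T - p" "t2 \<in> T - p" using q(2,5) pq by auto
      \<comment> \<open>Both vertices are used by \<open>q\<close>, whereas \<open>j\<close> and its
        successor occur only in \<open>p\<close>; so the four deleted vertices are distinct.\<close>
      have "k \<in> t1 \<union> t2" "(k + 1) mod m \<in> t1 \<union> t2"
        unfolding q(6) using q(1) by (simp_all add: quad_def)
      then have ne: "j \<noteq> k" "j \<noteq> (k + 1) mod m" "(j + 1) mod m \<noteq> k" "(j + 1) mod m \<noteq> (k + 1) mod m"
        using p(7)[OF tp(1)] p(7)[OF tp(2)] by auto
      then have far: "cyc_far m j k" using p(1) q(1) by (auto simp: cyc_far_def)
      have "admissible ({0..<m} - {j, (j + 1) mod m, k, (k + 1) mod m}) (T - {s1, s2, t1, t2}) a"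
      proof (rule remove_two_squares)
        show "j \<notin> t \<and> (j + 1) mod m \<notin> t \<and> k \<notin> t \<and> (k + 1) mod m \<notin> t"
          if "t \<in> T - {s1, s2, t1, t2}" for t
          using p(7)[of t] q(7)[of t] that p(2) q(2) by simp
        show "{s1, s2} \<inter> {t1, t2} = {}" using pq p(2) q(2) by simp
      qed (use p(1-5) q(1-5) far ne(4) in simp_all)
      moreover have "{s1, s2} \<in> P" "{t1, t2} \<in> P" using p(2,4) q(2,4) by simp_all
      ultimately have ?C4 using p(1,6) q(1,6) far by blast
      then show ?thesis by blast
    qed
  qed
qed

end
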